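(* Let $n\ge 3$. Let $U\subset \mathcal S^{n\times n}_+$ be an open set such that $O^{-1}UO=U$ for all $O\in O(n)$, and such that $U\cap\{M+tN \mid 0<t<\infty\}$ is convex for all $M\in\mathcal S^{n\times n}$ and all $N\in\mathcal S^{n\times n}_+$. Let $F\in C^1(U)$ satisfy $F(O^{-1}MO)=F(M)$ for all $M\in U$, $O\in O(n)$, and assume the matrix $\left(\frac{\partial F}{\partial M_{ij}}(M)\right)$ is positive definite for all $M\in U$. Let $u\in C^2(B_2\setminus\{0\})$ satisfy $$u>0,\quad A^u\in U,\quad F(A^u)=1\qquad\text{in } B_2\setminus\{0\}.$$ Then $u$ can be extended as a positive Lipschitz function in $B_1$.
   Context: $\mathcal S^{n\times n}$ is the set of real symmetric $n\times n$ matrices, $\mathcal S^{n\times n}_+$ the subset of positive definite ones, $O(n)$ the real orthogonal $n\times n$ matrices. $B_a(x)\subset\mathbb R^n$ is the ball of radius $a$ centered at $x$, $B_a=B_a(0)$. For a positive $C^2$ function $u$, $$A^u=-\frac{2}{n-2}u^{-\frac{n+2}{n-2}}\nabla^2u+\frac{2n}{(n-2)^2}u^{-\frac{2n}{n-2}}\nabla u\otimes\nabla u-\frac{2}{(n-2)^2}u^{-\frac{2n}{n-2}}|\nabla u|^2 I,$$ where $\nabla u$ is the gradient, $\nabla^2u$ the Hessian of $u$ and $I$ the identity matrix. *)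

theory Defs
  imports "HOL-Analysis.Analysis"
begin

definition sym_matrices :: "(real ^ 'n ^ 'n) set" where
  "sym_matrices = {M. transpose M = M}"

definition pos_def_matrices :: "(real ^ 'n ^ 'n) set" where
  "pos_def_matrices = {M \<in> sym_matrices. \<forall>x. x \<noteq> 0 \<longrightarrow> 0 < x \<bullet> (M *v x)}"

definition grad :: "(real ^ 'n \<Rightarrow> real) \<Rightarrow> real ^ 'n \<Rightarrow> real ^ 'n" where
  "grad u x = (\<chi> i. frechet_derivative u (at x) (axis i 1))"

definition hessian :: "(real ^ 'n \<Rightarrow> real) \<Rightarrow> real ^ 'n \<Rightarrow> real ^ 'n ^ 'n" where
  "hessian u x = jacobian (grad u) (at x)"

text \<open>Intended for open \<open>S\<close>, since the derivatives are taken at \<open>x\<close> in the full space.\<close>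

definition C2_on :: "(real ^ 'n) set \<Rightarrow> (real ^ 'n \<Rightarrow> real) \<Rightarrow> bool" where
  "C2_on S u \<longleftrightarrow>
     (\<forall>x\<in>S. u differentiable (at x)) \<and> continuous_on S (grad u) \<and>
     (\<forall>x\<in>S. grad u differentiable (at x)) \<and> continuous_on S (hessian u)"

definition tensor :: "real ^ 'n \<Rightarrow> real ^ 'n \<Rightarrow> real ^ 'n ^ 'n" where
  "tensor v w = (\<chi> i j. v $ i * w $ j)"

definition A_op :: "(real ^ 'n \<Rightarrow> real) \<Rightarrow> real ^ 'n \<Rightarrow> real ^ 'n ^ 'n" where
  "A_op u x = (let n = real CARD('n) in
     - (2 / (n - 2) * u x powr (- ((n + 2) / (n - 2)))) *\<^sub>R hessian u x
     + (2 * n / (n - 2)\<^sup>2 * u x powr (- (2 * n / (n - 2)))) *\<^sub>R tensor (grad u x) (grad u x)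
     - (2 / (n - 2)\<^sup>2 * u x powr (- (2 * n / (n - 2))) * (norm (grad u x))\<^sup>2) *\<^sub>R mat 1)"

text \<open>
  The matrix \<open>(\<partial>F/\<partial>M\<^sub>i\<^sub>j)\<close> of a function \<open>F\<close> defined on symmetric matrices only.
  The entries are normalised as usual for functions of symmetric matrices, so that
  \<open>dF(M)(H) = \<Sum>\<^sub>i\<^sub>j \<partial>F/\<partial>M\<^sub>i\<^sub>j H\<^sub>i\<^sub>j\<close> for symmetric \<open>H\<close> (see \<open>sym_grad_inner\<close>); that is,
  \<open>\<partial>F/\<partial>M\<^sub>i\<^sub>j\<close> is the derivative in the direction of the symmetric part of the matrix unit
  \<open>E\<^sub>i\<^sub>j\<close>, and \<open>F\<close> is never evaluated at a nonsymmetric matrix.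
\<close>

definition sym_unit :: "'n \<Rightarrow> 'n \<Rightarrow> real ^ 'n ^ 'n" where
  "sym_unit i j = (1/2) *\<^sub>R (axis i (axis j 1) + axis j (axis i 1))"

definition sym_grad :: "(real ^ 'n ^ 'n \<Rightarrow> real) \<Rightarrow> real ^ 'n ^ 'n \<Rightarrow> real ^ 'n ^ 'n" where
  "sym_grad F M = (\<chi> i j. deriv (\<lambda>t. F (M + t *\<^sub>R sym_unit i j)) 0)"

text \<open>\<open>C\<^sup>1(U)\<close> for \<open>U\<close> open in the space of symmetric matrices.\<close>

definition C1_on_sym :: "(real ^ 'n ^ 'n) set \<Rightarrow> (real ^ 'n ^ 'n \<Rightarrow> real) \<Rightarrow> bool" where
  "C1_on_sym U F \<longleftrightarrow>
     (\<forall>M\<in>U. F differentiable (at M within U)) \<and> continuous_on U (sym_grad F)"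

lemma deriv_along_sym:
  fixes F :: "real ^ 'n ^ 'n \<Rightarrow> real"
  assumes U: "openin (top_of_set sym_matrices) U" and M: "M \<in> U"
    and F: "(F has_derivative F') (at M within U)" and H: "H \<in> sym_matrices"
  shows "((\<lambda>t. F (M + t *\<^sub>R H)) has_field_derivative F' H) (at 0)"
proof -
  obtain T where T: "open T" "U = sym_matrices \<inter> T"
    using U by (auto simp: openin_open)
  define S where "S = (\<lambda>t::real. M + t *\<^sub>R H) -` T"
  have S: "open S" unfolding S_def
    by (intro open_vimage T continuous_intros)
  have S0: "0 \<in> S" using M T by (simp add: S_def)
  have "(\<lambda>t. M + t *\<^sub>R H) ` S \<subseteq> U"
    using M T H by (auto simp: S_def sym_matrices_def transpose_def vec_eq_iff)
  moreover have "((\<lambda>t. M + t *\<^sub>R H) has_derivative (\<lambda>t. t *\<^sub>R H)) (at 0 within S)"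
    by (auto intro!: derivative_eq_intros)
  ultimately have "((\<lambda>t. F (M + t *\<^sub>R H)) has_derivative (\<lambda>t. F' (t *\<^sub>R H))) (at 0 within S)"
    using has_derivative_in_compose[of "\<lambda>t. M + t *\<^sub>R H" "\<lambda>t. t *\<^sub>R H" 0 S F F']
      has_derivative_subset[OF F] by simp
  moreover have "(\<lambda>t. F' (t *\<^sub>R H)) = (*) (F' H)"
    using has_derivative_linear[OF F] by (auto simp: linear_cmul mult.commute)
  ultimately show ?thesis
    using at_within_open[OF S0 S] by (simp add: has_field_derivative_def)
qed

lemma sym_grad_inner:
  fixes F :: "real ^ 'n ^ 'n \<Rightarrow> real"
  assumes U: "openin (top_of_set sym_matrices) U" and M: "M \<in> U"
    and F: "(F has_derivative F') (at M within U)" and H: "H \<in> sym_matrices"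
  shows "F' H = (\<Sum>i\<in>UNIV. \<Sum>j\<in>UNIV. sym_grad F M $ i $ j * H $ i $ j)"
proof -
  have lin: "linear F'" using F by (rule has_derivative_linear)
  have "sym_unit i j \<in> sym_matrices" for i j :: 'n
    by (auto simp: sym_unit_def sym_matrices_def transpose_def vec_eq_iff axis_def)
  then have g: "sym_grad F M $ i $ j = F' (sym_unit i j)" for i j
    using DERIV_imp_deriv[OF deriv_along_sym[OF U M F]] by (simp add: sym_grad_def)
  have Hs: "H $ j $ i = H $ i $ j" for i j
    using H by (simp add: sym_matrices_def transpose_def vec_eq_iff)
  have "(\<Sum>i\<in>UNIV. \<Sum>j\<in>UNIV. H $ i $ j *\<^sub>R sym_unit i j) $ k $ l = H $ k $ l" for k l
  proof -
    have "(\<Sum>i\<in>UNIV. \<Sum>j\<in>UNIV. H $ i $ j *\<^sub>R sym_unit i j) $ k $ l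
      = (\<Sum>i\<in>UNIV. \<Sum>j\<in>UNIV. (if i = k then if j = l then H $ i $ j / 2 else 0 else 0)
           + (if i = l then if j = k then H $ i $ j / 2 else 0 else 0))"
      by (auto simp: sym_unit_def axis_def intro!: sum.cong)
    also have "\<dots> = H $ k $ l / 2 + H $ l $ k / 2"
    proof -
      have "(\<Sum>j\<in>UNIV. if i = a then if j = b then H $ i $ j / 2 else 0 else 0)
        = (if i = a then H $ i $ b / 2 else 0)" for i a b
        by simp
      then show ?thesis by (simp only: sum.distrib) simp
    qed
    finally show ?thesis by (simp add: Hs)
  qed
  then have "H = (\<Sum>i\<in>UNIV. \<Sum>j\<in>UNIV. H $ i $ j *\<^sub>R sym_unit i j)"
    by (simp add: vec_eq_iff)
  then have "F' H = F' (\<Sum>i\<in>UNIV. \<Sum>j\<in>UNIV. H $ i $ j *\<^sub>R sym_unit i j)" by simp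
  also have "\<dots> = (\<Sum>i\<in>UNIV. \<Sum>j\<in>UNIV. H $ i $ j * F' (sym_unit i j))"
    by (simp add: linear_sum[OF lin] linear_cmul[OF lin])
  finally show ?thesis by (simp add: g mult.commute)
qed

end

theory Submission
  imports Defs
begin

text \<open>
  The idea is to pass from \<open>u\<close> to the negative power \<open>v = u powr (- 1 / (n - 2))\<close>, for which
  positivity of \<open>A\<^sup>u\<close> is a strong form of convexity. A computation gives
  \<open>A\<^sup>u = 2 v\<^sup>2 (v \<nabla>\<^sup>2v + \<nabla>v \<otimes> \<nabla>v - |\<nabla>v|\<^sup>2 I)\<close>, so that \<open>U\<close> consisting of positive
  definite matrices means \<open>|\<nabla>v|\<^sup>2 I - \<nabla>v \<otimes> \<nabla>v < v \<nabla>\<^sup>2v\<close> in the sense of quadratic forms.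
  The left side is positive semidefinite by Cauchy-Schwarz, hence \<open>v\<close> is convex along segments of
  the punctured ball.

  A point is negligible for convexity in dimension at least two: a segment through the
  origin is a limit of segments that avoid it. Thus the graph of \<open>v\<close> lies above each of its tangent
  planes on the whole punctured ball (\<open>tangent_le\<close>). Following the gradient direction up
  to a fixed sphere then bounds \<open>\<nabla>v\<close> near the origin (\<open>gradient_bounded\<close>), and \<open>v\<close> extends
  as a Lipschitz function.

  It remains to exclude the value 0 of the extension at the origin, which is where a
  singularity of \<open>u\<close> would occur. Let \<open>x\<close> be a maximum point of \<open>v\<close> on the unit sphere and let
  \<open>v\<^sub>r\<close> be the radial derivative there. Along a unit tangent vector \<open>e\<close> the second derivative of \<open>v\<close>
  on the great circle is \<open>v\<^sub>e\<^sub>e - v\<^sub>r \<le> 0\<close>, while the inequality above gives \<open>v\<^sub>r\<^sup>2 < v v\<^sub>e\<^sub>e\<close>; together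
  these give \<open>v\<^sub>r < v\<close> at \<open>x\<close> (\<open>radial_less_at_sphere_max\<close>). The tangent plane at \<open>x\<close> has the
  value \<open>v - v\<^sub>r\<close> at the origin, which is therefore a positive lower bound for the limit of \<open>v\<close>
  there (\<open>limit_pos\<close>). So the extension of \<open>v\<close> is bounded below by a positive constant, and
  \<open>u = v powr (- (n - 2))\<close> inherits the Lipschitz bound.
\<close>

section \<open>The convexity inequality equivalent to positivity of the conformal Hessian\<close>

text \<open>
  Here \<open>g\<close> and \<open>H\<close> stand for the gradient and the Hessian of \<open>v\<close>. The condition \<open>conf\<close> is invariant
  under Kelvin transforms; the borderline solution \<open>v x = norm x\<close>, which turns it into an
  equality, shows that a weak inequality would leave room for a zero at the origin.
\<close>

locale conformally_convex =
  fixes v :: "'a::euclidean_space \<Rightarrow> real" and g :: "'a \<Rightarrow> 'a" and H :: "'a \<Rightarrow> 'a \<Rightarrow> 'a"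
  assumes dim: "2 \<le> DIM('a)"
    and pos: "\<And>x. x \<in> ball 0 2 - {0} \<Longrightarrow> 0 < v x"
    and deriv_v: "\<And>x. x \<in> ball 0 2 - {0} \<Longrightarrow> (v has_derivative (\<lambda>h. g x \<bullet> h)) (at x)"
    and deriv_g: "\<And>x. x \<in> ball 0 2 - {0} \<Longrightarrow> (g has_derivative H x) (at x)"
    and conf: "\<And>x e. x \<in> ball 0 2 - {0} \<Longrightarrow> e \<noteq> 0 \<Longrightarrow>
      (norm (g x))\<^sup>2 * (norm e)\<^sup>2 - (g x \<bullet> e)\<^sup>2 < v x * (e \<bullet> H x e)"
begin

text \<open>By Cauchy-Schwarz the lower bound in \<open>conf\<close> is nonnegative.\<close>

lemma hessian_pos:
  assumes x: "x \<in> ball 0 2 - {0}" and e: "e \<noteq> 0"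
  shows "0 < e \<bullet> H x e"
proof -
  have "(g x \<bullet> e)\<^sup>2 \<le> (norm (g x))\<^sup>2 * (norm e)\<^sup>2"
    using Cauchy_Schwarz_ineq[of "g x" e] by (simp add: power2_norm_eq_inner)
  then have "0 < v x * (e \<bullet> H x e)" using conf[OF x e] by linarith
  then show ?thesis using pos[OF x] by (simp add: zero_less_mult_iff)
qed

section \<open>Convexity across the origin\<close>

lemma continuous_on_v: "continuous_on (ball 0 2 - {0}) v"
  using deriv_v has_derivative_continuous continuous_at_imp_continuous_on by blast

lemma tangent_le_segment:
  assumes seg: "closed_segment x y \<subseteq> ball 0 2 - {0}"
  shows "v x + g x \<bullet> (y - x) \<le> v y"
proof -
  define \<gamma> where "\<gamma> t = x + t *\<^sub>R (y - x)" for t :: real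
  have \<gamma>: "\<gamma> t \<in> ball 0 2 - {0}" if "0 \<le> t" "t \<le> 1" for t
  proof -
    have "\<gamma> t = (1 - t) *\<^sub>R x + t *\<^sub>R y" by (simp add: \<gamma>_def algebra_simps)
    then have "\<gamma> t \<in> closed_segment x y" using that by (auto simp: in_segment)
    with seg show ?thesis by blast
  qed
  have d\<gamma>: "(\<gamma> has_derivative (\<lambda>h. h *\<^sub>R (y - x))) (at t)" for t
    unfolding \<gamma>_def by (auto intro!: derivative_eq_intros)
  have d1: "((\<lambda>t. v (\<gamma> t)) has_real_derivative g (\<gamma> t) \<bullet> (y - x)) (at t)"
    if "0 \<le> t" "t \<le> 1" for t
    by (rule has_derivative_imp_has_field_derivative[OF
          has_derivative_compose[OF d\<gamma> deriv_v[OF \<gamma>[OF that]]]]) simp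
  have d2: "((\<lambda>t. g (\<gamma> t) \<bullet> (y - x)) has_real_derivative H (\<gamma> t) (y - x) \<bullet> (y - x)) (at t)"
    if "0 \<le> t" "t \<le> 1" for t
  proof -
    have "linear (H (\<gamma> t))" using deriv_g[OF \<gamma>[OF that]] by (rule has_derivative_linear)
    then show ?thesis
      by (intro has_derivative_imp_has_field_derivative[OF
            has_derivative_inner_left[OF has_derivative_compose[OF d\<gamma> deriv_g[OF \<gamma>[OF that]]]]])
        (simp add: linear_cmul)
  qed
  have nonneg: "0 \<le> H (\<gamma> t) (y - x) \<bullet> (y - x)" if "0 \<le> t" "t \<le> 1" for t
    using hessian_pos[OF \<gamma>[OF that], of "y - x"] by (cases "y = x") (auto simp: inner_commute)
  obtain z where z: "0 < z" "z < 1" "v (\<gamma> 1) - v (\<gamma> 0) = (1 - 0) * (g (\<gamma> z) \<bullet> (y - x))"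
    using MVT2[of 0 1 "\<lambda>t. v (\<gamma> t)" "\<lambda>t. g (\<gamma> t) \<bullet> (y - x)"] d1 by auto
  have "g (\<gamma> 0) \<bullet> (y - x) \<le> g (\<gamma> z) \<bullet> (y - x)"
  proof (rule DERIV_nonneg_imp_nondecreasing[of 0 z "\<lambda>t. g (\<gamma> t) \<bullet> (y - x)"])
    show "\<exists>D. ((\<lambda>t. g (\<gamma> t) \<bullet> (y - x)) has_real_derivative D) (at t) \<and> 0 \<le> D"
      if "0 \<le> t" "t \<le> z" for t
      using d2[of t] nonneg[of t] that z by auto
  qed (use z in simp)
  with z show ?thesis by (simp add: \<gamma>_def)
qed

text \<open>
  If the segment from \<open>x\<close> to \<open>y\<close> meets the origin, then \<open>y\<close> is a limit of points \<open>y + s e\<close> with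
  \<open>e\<close> orthogonal to \<open>x\<close> (and hence to \<open>y\<close>) whose segments to \<open>x\<close> avoid it. This needs
  dimension at least two: on the line, \<open>1 - norm x / 3\<close> is locally affine off the origin
  but not convex.
\<close>

lemma tangent_le:
  assumes x: "x \<in> ball 0 2 - {0}" and y: "y \<in> ball 0 2 - {0}"
  shows "v x + g x \<bullet> (y - x) \<le> v y"
proof (cases "0 \<in> closed_segment x y")
  case False
  have "closed_segment x y \<subseteq> ball 0 2"
    using x y by (intro closed_segment_subset) auto
  with False show ?thesis by (intro tangent_le_segment) auto
next
  case True
  obtain e where e: "e \<noteq> 0" "x \<bullet> e = 0"
    using orthogonal_to_vector_exists[OF dim, of x] by (auto simp: orthogonal_def)
  obtain t where t: "0 = (1 - t) *\<^sub>R x + t *\<^sub>R y"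
    using True by (auto simp: closed_segment_def)
  have "t \<noteq> 0" using t x by auto
  moreover have "t * (y \<bullet> e) = 0"
    using arg_cong[OF t, of "\<lambda>z. z \<bullet> e"] e by (simp add: inner_add_left)
  ultimately have ye: "y \<bullet> e = 0" by simp
  have off: "0 \<notin> closed_segment x (y + s *\<^sub>R e)" if "0 < s" for s
  proof
    assume "0 \<in> closed_segment x (y + s *\<^sub>R e)"
    then obtain r where r: "0 = (1 - r) *\<^sub>R x + r *\<^sub>R (y + s *\<^sub>R e)"
      by (auto simp: closed_segment_def)
    have "r * (s * (e \<bullet> e)) = 0"
      using arg_cong[OF r, of "\<lambda>z. z \<bullet> e"] e ye by (simp add: inner_add_left)
    then have "r = 0" using that e by simp
    with r x show False by simp
  qed
  have lim: "((\<lambda>s. y + s *\<^sub>R e) \<longlongrightarrow> y) (at_right 0)"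
    by (auto intro!: tendsto_eq_intros)
  have "isCont v y" using deriv_v[OF y] by (rule has_derivative_continuous)
  then have "((\<lambda>s. v (y + s *\<^sub>R e)) \<longlongrightarrow> v y) (at_right 0)"
    using lim by (rule isCont_tendsto_compose)
  moreover have "((\<lambda>s. v x + g x \<bullet> (y + s *\<^sub>R e - x)) \<longlongrightarrow> v x + g x \<bullet> (y - x)) (at_right 0)"
    using lim by (intro tendsto_intros)
  moreover have "\<forall>\<^sub>F s in at_right 0. y + s *\<^sub>R e \<in> ball 0 2"
    using lim y by (intro topological_tendstoD) auto
  then have "\<forall>\<^sub>F s in at_right 0. v x + g x \<bullet> (y + s *\<^sub>R e - x) \<le> v (y + s *\<^sub>R e)"
    using eventually_at_right_less[of 0]
  proof eventually_elim
    case (elim s)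
    then have "closed_segment x (y + s *\<^sub>R e) \<subseteq> ball 0 2"
      using x by (intro closed_segment_subset) auto
    then show ?case using off elim by (intro tangent_le_segment) auto
  qed
  ultimately show ?thesis by (intro tendsto_le[of "at_right 0"]) auto
qed

section \<open>Lipschitz bound near the origin\<close>

text \<open>
  Start at \<open>x\<close> in the unit ball and go in the direction of the gradient until the sphere of
  radius \<open>3/2\<close> is hit, at a distance of at least \<open>1/2\<close>. By convexity \<open>v\<close> grows at least at the
  rate \<open>norm (g x)\<close> on the way; it starts positive and ends below its maximum on that sphere, which
  is a bound independent of \<open>x\<close>.
\<close>

lemma gradient_bounded: "\<exists>L\<ge>0. \<forall>x \<in> cball 0 1 - {0}. norm (g x) \<le> L"
proof -
  have "bounded (v ` sphere 0 (3/2))"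
    by (intro compact_imp_bounded compact_continuous_image continuous_on_subset[OF continuous_on_v])
      auto
  then obtain M where M: "M > 0" "\<And>y. norm y = 3/2 \<Longrightarrow> \<bar>v y\<bar> \<le> M"
    by (auto simp: bounded_pos)
  have "norm (g x) \<le> 2 * M" if x: "x \<in> cball 0 1 - {0}" for x
  proof (cases "g x = 0")
    case False
    define e where "e = g x /\<^sub>R norm (g x)"
    have e: "norm e = 1" "g x \<bullet> e = norm (g x)"
      using False by (auto simp: e_def dot_square_norm power2_eq_square)
    have "\<exists>s\<ge>0. s \<le> 5/2 \<and> norm (x + s *\<^sub>R e) = 3/2"
    proof (rule IVT')
      show "3/2 \<le> norm (x + (5/2) *\<^sub>R e)"
        using norm_diff_ineq[of "(5/2) *\<^sub>R e" x] e x by (simp add: add.commute)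
    qed (use x in \<open>auto intro!: continuous_intros\<close>)
    then obtain s where s: "0 \<le> s" "norm (x + s *\<^sub>R e) = 3/2" by blast
    have "3/2 \<le> 1 + s"
      using norm_triangle_ineq[of x "s *\<^sub>R e"] s e x by simp
    then have "norm (g x) \<le> 2 * (s * norm (g x))"
      using mult_right_mono[of "1/2" s "norm (g x)"] by simp
    moreover have "x + s *\<^sub>R e \<in> ball 0 2 - {0}"
      using s(2) by (auto simp del: norm_eq_zero) 
    then have "v x + s * norm (g x) \<le> v (x + s *\<^sub>R e)"
      using tangent_le[of x "x + s *\<^sub>R e"] x e by simp
    moreover have "v (x + s *\<^sub>R e) \<le> M" using M(2)[OF s(2)] by simp
    moreover have "0 < v x" using x by (intro pos) auto
    ultimately show ?thesis by linarith
  qed (use M in auto)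
  with M show ?thesis by (intro exI[of _ "2 * M"]) auto
qed

lemma lipschitz_punctured: "\<exists>L. L-lipschitz_on (cball 0 1 - {0}) v"
proof -
  obtain L where L: "L \<ge> 0" "\<And>x. x \<in> cball 0 1 - {0} \<Longrightarrow> norm (g x) \<le> L"
    using gradient_bounded by auto
  have le: "v x - v y \<le> L * dist x y" if x: "x \<in> cball 0 1 - {0}" and y: "y \<in> cball 0 1 - {0}" for x y
  proof -
    have "v x - v y \<le> g x \<bullet> (x - y)"
      using tangent_le[of x y] x y by (auto simp: inner_diff_right)
    also have "\<dots> \<le> norm (g x) * norm (x - y)" by (rule norm_cauchy_schwarz)
    also have "\<dots> \<le> L * norm (x - y)" using L(2)[OF x] by (rule mult_right_mono) simp
    finally show ?thesis by (simp add: dist_norm)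
  qed
  have "L-lipschitz_on (cball 0 1 - {0}) v"
    using L(1) le by (intro lipschitz_onI) (force simp: dist_real_def abs_le_iff dist_commute)+
  then show ?thesis ..
qed

section \<open>Positivity of the limit at the origin\<close>

text \<open>
  If the radial derivative \<open>v\<^sub>r\<close> were at least \<open>v\<close>, then \<open>v\<^sub>r\<^sup>2 < v v\<^sub>e\<^sub>e \<le> v\<^sub>r v\<^sub>e\<^sub>e\<close> for a unit tangent
  vector \<open>e\<close>, because \<open>g x\<close> is orthogonal to \<open>e\<close> at a maximum. Hence \<open>v\<^sub>e\<^sub>e - v\<^sub>r\<close>, the second
  derivative of \<open>v\<close> along the great circle through \<open>x\<close> in direction \<open>e\<close>, would be positive, and \<open>x\<close>
  could not be a maximum.
\<close>

lemma radial_less_at_sphere_max: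
  assumes x: "norm x = 1" and max: "\<And>y. norm y = 1 \<Longrightarrow> v y \<le> v x"
  shows "g x \<bullet> x < v x"
proof (rule ccontr)
  assume "\<not> g x \<bullet> x < v x"
  then have rad: "v x \<le> g x \<bullet> x" by simp
  have xD: "x \<in> ball 0 2 - {0}" using x by auto
  obtain e0 where e0: "e0 \<noteq> 0" "x \<bullet> e0 = 0"
    using orthogonal_to_vector_exists[OF dim, of x] by (auto simp: orthogonal_def)
  define e where "e = e0 /\<^sub>R norm e0"
  have e: "norm e = 1" "x \<bullet> e = 0" using e0 by (auto simp: e_def)
  define \<gamma> where "\<gamma> t = cos t *\<^sub>R x + sin t *\<^sub>R e" for t :: real
  define \<tau> where "\<tau> t = cos t *\<^sub>R e - sin t *\<^sub>R x" for t :: real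
  have n\<gamma>: "norm (\<gamma> t) = 1" for t
  proof -
    have "(norm (\<gamma> t))\<^sup>2 = (cos t)\<^sup>2 * (x \<bullet> x) + (sin t)\<^sup>2 * (e \<bullet> e)"
      using e(2) unfolding power2_norm_eq_inner
      by (simp add: \<gamma>_def inner_add_left inner_add_right inner_commute power2_eq_square algebra_simps)
    also have "\<dots> = 1" using x e by (simp add: dot_square_norm)
    finally show ?thesis using norm_ge_zero[of "\<gamma> t"] by (simp add: power2_eq_1_iff)
  qed
  have \<gamma>D: "\<gamma> t \<in> ball 0 2 - {0}" for t using n\<gamma>[of t] by auto
  have d\<gamma>: "(\<gamma> has_derivative (\<lambda>h. h *\<^sub>R \<tau> t)) (at t)" for t
    unfolding \<gamma>_def \<tau>_def by (auto intro!: derivative_eq_intros simp: algebra_simps)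
  have d\<tau>: "(\<tau> has_derivative (\<lambda>h. h *\<^sub>R (- \<gamma> t))) (at t)" for t
    unfolding \<gamma>_def \<tau>_def by (auto intro!: derivative_eq_intros simp: algebra_simps)
  have d1: "((\<lambda>t. v (\<gamma> t)) has_real_derivative g (\<gamma> t) \<bullet> \<tau> t) (at t)" for t
    by (rule has_derivative_imp_has_field_derivative[OF has_derivative_compose[OF d\<gamma> deriv_v[OF \<gamma>D]]])
      simp
  have lin: "linear (H (\<gamma> 0))" using deriv_g[OF \<gamma>D] by (rule has_derivative_linear)
  have d2: "((\<lambda>t. g (\<gamma> t) \<bullet> \<tau> t) has_real_derivative
      H (\<gamma> 0) (\<tau> 0) \<bullet> \<tau> 0 - g (\<gamma> 0) \<bullet> \<gamma> 0) (at 0)"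
    by (rule has_derivative_imp_has_field_derivative[OF
          has_derivative_inner[OF has_derivative_compose[OF d\<gamma> deriv_g[OF \<gamma>D]] d\<tau>]])
      (simp add: linear_cmul[OF lin] right_diff_distrib)
  have \<gamma>0: "\<gamma> 0 = x" "\<tau> 0 = e" by (auto simp: \<gamma>_def \<tau>_def)
  have "g (\<gamma> 0) \<bullet> \<tau> 0 = 0"
    using max n\<gamma> \<gamma>0 by (intro DERIV_local_max[OF d1, of 1]) auto
  then have ge: "g x \<bullet> e = 0" by (simp add: \<gamma>0)
  have ene: "e \<noteq> 0" using e by auto
  have "g x \<bullet> x < e \<bullet> H x e"
  proof -
    have "(g x \<bullet> x)\<^sup>2 \<le> (norm (g x))\<^sup>2"
      using Cauchy_Schwarz_ineq2[of "g x" x] x by (simp add: abs_le_square_iff[symmetric])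
    also have "\<dots> < v x * (e \<bullet> H x e)"
      using conf[OF xD ene] by (simp only: e(1) ge) simp
    also have "\<dots> \<le> (g x \<bullet> x) * (e \<bullet> H x e)"
      using rad hessian_pos[OF xD ene] by (intro mult_right_mono) auto
    finally show ?thesis
      using rad pos[OF xD] by (simp only: power2_eq_square mult_less_cancel_left_pos less_le_trans)
  qed
  then have "0 < H (\<gamma> 0) (\<tau> 0) \<bullet> \<tau> 0 - g (\<gamma> 0) \<bullet> \<gamma> 0"
    by (simp add: \<gamma>0 inner_commute)
  \<comment> \<open>The derivative along the circle vanishes at 0 and then turns positive: \<open>v\<close> exceeds \<open>v x\<close> nearby.\<close>
  from has_real_derivative_pos_inc_right[OF d2 this]
  obtain d where d: "d > 0" "\<And>h. 0 < h \<Longrightarrow> h < d \<Longrightarrow> 0 < g (\<gamma> h) \<bullet> \<tau> h"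
    using ge \<gamma>0 by auto
  obtain z where z: "0 < z" "z < d / 2" "v (\<gamma> (d / 2)) - v (\<gamma> 0) = (d / 2 - 0) * (g (\<gamma> z) \<bullet> \<tau> z)"
    using MVT2[of 0 "d / 2" "\<lambda>t. v (\<gamma> t)" "\<lambda>t. g (\<gamma> t) \<bullet> \<tau> t"] d1 d(1) by auto
  have "0 < (d / 2 - 0) * (g (\<gamma> z) \<bullet> \<tau> z)"
    using z(1,2) d by (intro mult_pos_pos) auto
  then have "v x < v (\<gamma> (d / 2))" using z(3) \<gamma>0(1) by simp
  with max[OF n\<gamma>] show False by (simp add: not_less[symmetric])
qed

text \<open>
  The tangent plane at a maximum point \<open>x\<close> of the unit sphere lies below \<open>v\<close>, and its value
  \<open>v x - g x \<bullet> x\<close> at the origin is positive.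
\<close>

lemma limit_pos:
  assumes lim: "(v \<longlongrightarrow> l) (at 0)"
  shows "0 < l"
proof -
  have "sphere (0::'a) 1 \<noteq> {}" by simp
  moreover have "continuous_on (sphere 0 1) v"
    by (intro continuous_on_subset[OF continuous_on_v]) auto
  ultimately obtain x where x: "norm x = 1" "\<And>y. norm y = 1 \<Longrightarrow> v y \<le> v x"
    using continuous_attains_sup[of "sphere (0::'a) 1" v] by auto
  have xD: "x \<in> ball 0 2 - {0}" using x by auto
  have "filterlim (\<lambda>y. v x + g x \<bullet> (y - x)) (nhds (v x + g x \<bullet> (0 - x))) (at 0)"
    by (intro tendsto_intros)
  moreover have "\<forall>\<^sub>F y in at 0. v x + g x \<bullet> (y - x) \<le> v y"
    unfolding eventually_at using tangent_le[OF xD]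
    by (intro exI[of _ 2]) (auto simp: dist_norm)
  ultimately have "v x + g x \<bullet> (0 - x) \<le> l"
    using lim by (intro tendsto_le[OF _ lim]) auto
  with radial_less_at_sphere_max[OF x] show ?thesis by (simp add: inner_diff_right)
qed

lemma lipschitz_extension:
  "\<exists>V L c. L-lipschitz_on (cball 0 1) V \<and> (\<forall>x \<in> cball 0 1 - {0}. V x = v x) \<and>
     0 < c \<and> (\<forall>x \<in> cball 0 1. c \<le> V x)"
proof -
  obtain L where "L-lipschitz_on (cball 0 1 - {0}) v" using lipschitz_punctured by blast
  from lipschitz_extend_closure[OF this]
  obtain V where V: "L-lipschitz_on (closure (cball 0 1 - {0})) V"
      "\<And>x. x \<in> cball 0 1 - {0} \<Longrightarrow> V x = v x" by auto
  have "closure (cball 0 1 - {0::'a}) = cball 0 1"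
  proof -
    have "(0::'a) \<in> interior (cball 0 1)" by simp
    then have "0 \<in> closure (cball 0 1 - {0::'a})"
      using interior_limit_point islimpt_in_closure by blast
    then show ?thesis
      using closure_insert[of 0 "cball 0 1 - {0::'a}"] by (simp add: insert_absorb)
  qed
  with V have lip: "L-lipschitz_on (cball 0 1) V" by simp
  then have cont: "continuous_on (cball 0 1) V" by (rule lipschitz_on_continuous_on)
  have "isCont V 0"
    using cont by (rule continuous_on_interior) simp
  then have "(V \<longlongrightarrow> V 0) (at 0)" by (simp add: isCont_def)
  moreover have "\<forall>\<^sub>F y in at 0. V y = v y"
    unfolding eventually_at using V(2) by (intro exI[of _ 1]) (auto simp: dist_norm)
  ultimately have "(v \<longlongrightarrow> V 0) (at 0)" by (rule Lim_transform_eventually)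
  then have V0: "0 < V 0" by (rule limit_pos)
  have Vpos: "0 < V x" if "x \<in> cball 0 1" for x
    using V0 V(2)[of x] pos[of x] that by (cases "x = 0") auto
  obtain m where m: "m \<in> cball 0 1" "\<And>x. x \<in> cball 0 1 \<Longrightarrow> V m \<le> V x"
    using continuous_attains_inf[OF compact_cball _ cont] by auto
  from lip V(2) m Vpos[OF m(1)] show ?thesis by blast
qed

end

section \<open>From the solution to the convex power\<close>

lemma lipschitz_on_powr_neg:
  fixes b c :: real
  assumes "0 \<le> b" "0 < c"
  shows "(b * c powr (- b - 1))-lipschitz_on {c..} (\<lambda>x. x powr (- b))"
proof (rule bounded_derivative_imp_lipschitz)
  show "((\<lambda>x. x powr (- b)) has_derivative (*) (- b * x powr (- b - 1))) (at x within {c..})"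
    if "x \<in> {c..}" for x
    using that assms has_field_derivative_at_within[OF has_real_derivative_powr[of x "- b"]]
    by (simp add: has_field_derivative_def)
  show "onorm ((*) (- b * x powr (- b - 1))) \<le> b * c powr (- b - 1)" if "x \<in> {c..}" for x
  proof (rule onorm_le)
    have "x powr (- b - 1) \<le> c powr (- b - 1)"
      using that assms by (intro powr_mono2') auto
    then have "\<bar>- b * x powr (- b - 1)\<bar> \<le> b * c powr (- b - 1)"
      using assms by (simp add: abs_mult mult_left_mono)
    then show "norm (- b * x powr (- b - 1) * h) \<le> b * c powr (- b - 1) * norm h" for h
      unfolding norm_mult by (intro mult_right_mono) auto
  qed
qed (use assms in auto)

lemma has_derivative_grad:
  fixes u :: "real ^ 'n \<Rightarrow> real"
  assumes "u differentiable (at x)"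
  shows "(u has_derivative (\<lambda>h. grad u x \<bullet> h)) (at x)"
proof -
  let ?D = "frechet_derivative u (at x)"
  have D: "(u has_derivative ?D) (at x)" using assms by (simp add: frechet_derivative_works)
  then have lin: "linear ?D" by (rule has_derivative_linear)
  have "?D h = grad u x \<bullet> h" for h
  proof -
    have "?D h = ?D (\<Sum>i\<in>UNIV. h $ i *\<^sub>R axis i 1)"
      using basis_expansion[of h] by (simp add: scalar_mult_eq_scaleR)
    also have "\<dots> = grad u x \<bullet> h"
      by (simp add: linear_sum[OF lin] linear_cmul[OF lin] grad_def inner_vec_def mult.commute)
    finally show ?thesis .
  qed
  then have "?D = (\<lambda>h. grad u x \<bullet> h)" by auto
  with D show ?thesis by simp
qed

lemma tensor_mult_vector: "tensor p q *v e = (q \<bullet> e) *\<^sub>R p"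
  by (simp add: tensor_def matrix_vector_mult_def vec_eq_iff inner_vec_def sum_distrib_right
      sum_distrib_left mult_ac)

text \<open>
  In terms of \<open>a = 1 / (n - 2)\<close> the exponents of \<open>u\<close> in \<open>A\<^sup>u\<close> are \<open>- 4 a - 1\<close> and \<open>- 4 a - 2\<close>,
  and the coefficients are \<open>2 a\<close>, \<open>2 a (1 + 2 a)\<close> and \<open>2 a\<^sup>2\<close>. Written this way, the form matches
  the one that comes from differentiating \<open>u powr - a\<close> twice.
\<close>

lemma A_op_quadratic_form:
  fixes u :: "real ^ 'n \<Rightarrow> real"
  assumes n: "CARD('n) \<ge> 3" and u: "0 < u x"
  defines "a \<equiv> 1 / (real CARD('n) - 2)"
  shows "e \<bullet> (A_op u x *v e) = 2 * a * u x powr (- 4 * a - 2) *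
     (- u x * (e \<bullet> (hessian u x *v e)) + (1 + 2 * a) * (grad u x \<bullet> e)\<^sup>2
      - a * (norm (grad u x))\<^sup>2 * (norm e)\<^sup>2)"
proof -
  have n0: "real CARD('n) - 2 \<noteq> 0" using n by linarith
  have c: "2 / (real CARD('n) - 2) = 2 * a" "2 * real CARD('n) / (real CARD('n) - 2)\<^sup>2 = 2 * a * (1 + 2 * a)"
    "2 / (real CARD('n) - 2)\<^sup>2 = 2 * a * a"
    "- ((real CARD('n) + 2) / (real CARD('n) - 2)) = - 4 * a - 2 + 1"
    "- (2 * real CARD('n) / (real CARD('n) - 2)) = - 4 * a - 2"
    using n0 by (auto simp: a_def field_simps power2_eq_square)
  have p: "u x powr (- 4 * a - 2 + 1) = u x powr (- 4 * a - 2) * u x"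
    using u by (subst powr_add) simp
  show ?thesis
    unfolding A_op_def Let_def c p
    by (simp add: matrix_vector_mult_add_rdistrib matrix_vector_mult_diff_rdistrib
        scaleR_matrix_vector_assoc[symmetric] tensor_mult_vector inner_add_right inner_diff_right
        dot_square_norm inner_commute power2_eq_square algebra_simps)
qed

text \<open>
  With \<open>q = u powr (- a - 1)\<close> and \<open>Q\<close> the parenthesised factor of \<open>A_op_quadratic_form\<close>, the two
  sides of the convexity inequality differ by exactly \<open>a q\<^sup>2 Q\<close>.
\<close>

lemma conformally_convex_power:
  fixes u :: "real ^ 'n \<Rightarrow> real"
  assumes n: "CARD('n) \<ge> 3"
    and C2: "C2_on (ball 0 2 - {0}) u"
    and u_pos: "\<And>x. x \<in> ball 0 2 - {0} \<Longrightarrow> 0 < u x"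
    and A_pos: "\<And>x. x \<in> ball 0 2 - {0} \<Longrightarrow> A_op u x \<in> pos_def_matrices"
  defines "a \<equiv> 1 / (real CARD('n) - 2)"
  shows "conformally_convex (\<lambda>x. u x powr - a)
    (\<lambda>x. (- a * u x powr (- a - 1)) *\<^sub>R grad u x)
    (\<lambda>x h. (- a * u x powr (- a - 1)) *\<^sub>R (hessian u x *v h)
      + (a * (a + 1) * u x powr (- a - 2) * (grad u x \<bullet> h)) *\<^sub>R grad u x)"
proof
  show "2 \<le> DIM(real ^ 'n)" using n by simp
next
  fix x :: "real ^ 'n" assume x: "x \<in> ball 0 2 - {0}"
  show "0 < u x powr - a" using u_pos[OF x] by simp
  have du: "(u has_derivative (\<lambda>h. grad u x \<bullet> h)) (at x)"
    using C2 x by (intro has_derivative_grad) (auto simp: C2_on_def)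
  have dpow: "((\<lambda>x. u x powr r) has_derivative (\<lambda>h. (grad u x \<bullet> h) * (r * u x powr (r - 1)))) (at x)" for r
    using DERIV_compose_FDERIV[OF has_real_derivative_powr[OF u_pos[OF x]] du] .
  show "((\<lambda>x. u x powr - a) has_derivative
      (\<lambda>h. ((- a * u x powr (- a - 1)) *\<^sub>R grad u x) \<bullet> h)) (at x)"
    using dpow[of "- a"] by (simp add: mult.commute)
  have dgrad: "(grad u has_derivative (\<lambda>h. hessian u x *v h)) (at x)"
    using C2 x unfolding hessian_def jacobian_works[symmetric] by (auto simp: C2_on_def)
  show "((\<lambda>x. (- a * u x powr (- a - 1)) *\<^sub>R grad u x) has_derivative
      (\<lambda>h. (- a * u x powr (- a - 1)) *\<^sub>R (hessian u x *v h)
        + (a * (a + 1) * u x powr (- a - 2) * (grad u x \<bullet> h)) *\<^sub>R grad u x)) (at x)"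
    by (rule has_derivative_eq_rhs[OF has_derivative_scaleR[OF
            has_derivative_mult_right[OF dpow[of "- a - 1"], of "- a"] dgrad]])
      (simp add: fun_eq_iff algebra_simps)
  fix e :: "real ^ 'n" assume e: "e \<noteq> 0"
  let ?p = "grad u x" and ?P = "e \<bullet> (hessian u x *v e)"
  let ?Q = "- u x * ?P + (1 + 2 * a) * (?p \<bullet> e)\<^sup>2 - a * (norm ?p)\<^sup>2 * (norm e)\<^sup>2"
  have a: "0 < a" using n by (simp add: a_def)
  have "0 < e \<bullet> (A_op u x *v e)"
    using A_pos[OF x] e by (simp add: pos_def_matrices_def)
  also have "\<dots> = 2 * a * u x powr (- 4 * a - 2) * ?Q"
    unfolding a_def using n u_pos[OF x] by (rule A_op_quadratic_form)
  finally have "0 < 2 * a * u x powr (- 4 * a - 2) * ?Q" .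
  moreover have "0 < 2 * a * u x powr (- 4 * a - 2)" using a u_pos[OF x] by simp
  ultimately have Q: "0 < ?Q" by (rule zero_less_mult_pos)
  define q where "q = u x powr (- a - 1)"
  have q: "0 < q" using u_pos[OF x] by (simp add: q_def)
  have va: "u x powr - a = q * u x"
    using u_pos[OF x] powr_add[of "u x" "- a - 1" 1] by (simp add: q_def)
  have vb: "u x powr - a * u x powr (- a - 2) = q * q"
    by (simp add: q_def powr_add[symmetric])
  have "u x powr - a * (e \<bullet> ((- a * q) *\<^sub>R (hessian u x *v e)
        + (a * (a + 1) * u x powr (- a - 2) * (?p \<bullet> e)) *\<^sub>R ?p))
      = (- a * q) * u x powr - a * ?P
        + a * (a + 1) * (u x powr - a * u x powr (- a - 2)) * (?p \<bullet> e)\<^sup>2"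
    by (simp add: inner_add_right inner_commute power2_eq_square algebra_simps)
  also have "\<dots> = (norm ((- a * q) *\<^sub>R ?p))\<^sup>2 * (norm e)\<^sup>2 - (((- a * q) *\<^sub>R ?p) \<bullet> e)\<^sup>2
      + a * (q * q) * ?Q"
    unfolding vb unfolding va by (simp add: power_mult_distrib power2_eq_square[of q]
        power2_eq_square[of a] algebra_simps)
  finally show "(norm ((- a * u x powr (- a - 1)) *\<^sub>R ?p))\<^sup>2 * (norm e)\<^sup>2
      - (((- a * u x powr (- a - 1)) *\<^sub>R ?p) \<bullet> e)\<^sup>2
      < u x powr - a * (e \<bullet> ((- a * u x powr (- a - 1)) *\<^sub>R (hessian u x *v e)
        + (a * (a + 1) * u x powr (- a - 2) * (?p \<bullet> e)) *\<^sub>R ?p))"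
    using mult_pos_pos[OF mult_pos_pos[OF a mult_pos_pos[OF q q]] Q] unfolding q_def by linarith
qed

theorem theorem1p4:
  fixes U :: "(real ^ 'n ^ 'n) set"
    and F :: "real ^ 'n ^ 'n \<Rightarrow> real"
    and u :: "real ^ 'n \<Rightarrow> real"
  assumes "CARD('n) \<ge> 3"
    and "U \<subseteq> pos_def_matrices"
    and "openin (top_of_set sym_matrices) U"
    and "\<And>Q :: real ^ 'n ^ 'n. orthogonal_matrix Q \<Longrightarrow> (\<lambda>M. matrix_inv Q ** M ** Q) ` U = U"
    and "\<And>M N. M \<in> sym_matrices \<Longrightarrow> N \<in> pos_def_matrices \<Longrightarrow>
           convex (U \<inter> {M + t *\<^sub>R N | t. 0 < t})"
    and "C1_on_sym U F"
    and "\<And>M Q. M \<in> U \<Longrightarrow> orthogonal_matrix Q \<Longrightarrow> F (matrix_inv Q ** M ** Q) = F M"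
    and "\<And>M. M \<in> U \<Longrightarrow> sym_grad F M \<in> pos_def_matrices"
    and "C2_on (ball 0 2 - {0}) u"
    and "\<And>x. x \<in> ball 0 2 - {0} \<Longrightarrow> u x > 0"
    and "\<And>x. x \<in> ball 0 2 - {0} \<Longrightarrow> A_op u x \<in> U"
    and "\<And>x. x \<in> ball 0 2 - {0} \<Longrightarrow> F (A_op u x) = 1"
  shows "\<exists>v :: real ^ 'n \<Rightarrow> real.
           (\<forall>x \<in> ball 0 1 - {0}. v x = u x) \<and>
           (\<forall>x \<in> ball 0 1. v x > 0) \<and>
           (\<exists>L. L-lipschitz_on (ball 0 1) v)"
proof -
  define a where "a = 1 / (real CARD('n) - 2)"
  define b where "b = real CARD('n) - 2"
  have ab: "0 \<le> b" "a * b = 1" using assms(1) by (auto simp: a_def b_def)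
  interpret conformally_convex "\<lambda>x. u x powr - a"
    "\<lambda>x. (- a * u x powr (- a - 1)) *\<^sub>R grad u x"
    "\<lambda>x h. (- a * u x powr (- a - 1)) *\<^sub>R (hessian u x *v h)
      + (a * (a + 1) * u x powr (- a - 2) * (grad u x \<bullet> h)) *\<^sub>R grad u x"
    unfolding a_def using assms(1,2,9-11) by (intro conformally_convex_power) auto
  obtain V L c where V: "L-lipschitz_on (cball 0 1) V"
      "\<And>x. x \<in> cball 0 1 - {0} \<Longrightarrow> V x = u x powr - a"
      and c: "0 < c" "\<And>x. x \<in> cball 0 1 \<Longrightarrow> c \<le> V x"
    using lipschitz_extension by blast
  have "L-lipschitz_on (ball 0 1) V"
    using V(1) by (rule lipschitz_on_subset) auto
  moreover have "(b * c powr (- b - 1))-lipschitz_on (V ` ball 0 1) (\<lambda>x. x powr (- b))"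
    by (rule lipschitz_on_subset[OF lipschitz_on_powr_neg[OF ab(1) c(1)]]) (use c(2) in auto)
  ultimately have "(b * c powr (- b - 1) * L)-lipschitz_on (ball 0 1) (\<lambda>x. V x powr (- b))"
    by (rule lipschitz_on_compose2)
  moreover have "V x powr (- b) = u x" if "x \<in> ball 0 1 - {0}" for x
    using that V(2)[of x] assms(10)[of x] ab(2) by (auto simp: powr_powr)
  moreover have "0 < V x powr (- b)" if "x \<in> ball 0 1" for x
    using that c(1) c(2)[of x] by auto
  ultimately show ?thesis by (intro exI[of _ "\<lambda>x. V x powr (- b)"]) blast
qed

end
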